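(* Let $n \geq 2$ be an integer, let $S$ be a ring and let $a,b \in S$ be $n$-potent elements. Then $a-b$ and $\langle a,b\rangle_n$ are both units in $S$ if and only if $a+b$, $[a,b]_n^L$ and $[a,b]_n^R$ are all units in $S$.
   Context: Rings are associative with unity, not necessarily commutative. An element $x$ of a ring is $n$-potent if $x^n = x$. For elements $a,b$ of a ring $S$ and an integer $n \geq 2$: the anti-commutator of degree $n$ is $\langle a,b\rangle_n := (a+b)^n - a^n - b^n$; the left commutator of degree $n$ is $[a,b]_n^L := (a-b)(a+b)^{n-1} - (a^n - b^n)$; the right commutator of degree $n$ is $[a,b]_n^R := (a+b)^{n-1}(a-b) - (a^n-b^n)$. A unit is a two-sided invertible element. *)

theory Defs
  imports "HOL-Algebra.Ring"
begin

definition n_potent :: "('a, 'm) ring_scheme \<Rightarrow> nat \<Rightarrow> 'a \<Rightarrow> bool" where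
  "n_potent S n x \<longleftrightarrow> x \<in> carrier S \<and> x [^]\<^bsub>S\<^esub> n = x"

definition anti_commutator :: "('a, 'm) ring_scheme \<Rightarrow> nat \<Rightarrow> 'a \<Rightarrow> 'a \<Rightarrow> 'a" where
  "anti_commutator S n a b =
     (a \<oplus>\<^bsub>S\<^esub> b) [^]\<^bsub>S\<^esub> n \<ominus>\<^bsub>S\<^esub> a [^]\<^bsub>S\<^esub> n \<ominus>\<^bsub>S\<^esub> b [^]\<^bsub>S\<^esub> n"

definition left_commutator :: "('a, 'm) ring_scheme \<Rightarrow> nat \<Rightarrow> 'a \<Rightarrow> 'a \<Rightarrow> 'a" where
  "left_commutator S n a b =
     ((a \<ominus>\<^bsub>S\<^esub> b) \<otimes>\<^bsub>S\<^esub> (a \<oplus>\<^bsub>S\<^esub> b) [^]\<^bsub>S\<^esub> (n - 1))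
       \<ominus>\<^bsub>S\<^esub> (a [^]\<^bsub>S\<^esub> n \<ominus>\<^bsub>S\<^esub> b [^]\<^bsub>S\<^esub> n)"

definition right_commutator :: "('a, 'm) ring_scheme \<Rightarrow> nat \<Rightarrow> 'a \<Rightarrow> 'a \<Rightarrow> 'a" where
  "right_commutator S n a b =
     ((a \<oplus>\<^bsub>S\<^esub> b) [^]\<^bsub>S\<^esub> (n - 1) \<otimes>\<^bsub>S\<^esub> (a \<ominus>\<^bsub>S\<^esub> b))
       \<ominus>\<^bsub>S\<^esub> (a [^]\<^bsub>S\<^esub> n \<ominus>\<^bsub>S\<^esub> b [^]\<^bsub>S\<^esub> n)"

end

theory Submission
  imports Defs
begin

text \<open>
  Put $s = a + b$, $d = a - b$ and $u = s^{n-1} - 1$. Since $a^n = a$ and $b^n = b$, all three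
  commutators factor through $u$: the anti-commutator is $s^n - s = su = us$, and the left and
  right commutators are $du$ and $ud$. In any monoid two elements are both units as soon as their
  products in both orders are units. Hence invertibility of the anti-commutator means that
  $s$ and $u$ are units, invertibility of the left and right commutators together means that
  $d$ and $u$ are units, and so each side of the equivalence says that $s$, $d$ and $u$ are units.
\<close>

text \<open>
  An inverse of $yx$ gives $x$ a left inverse and an inverse of $xy$ gives it a right inverse,
  and the two must agree. Without commutativity a single invertible product would only yield
  one-sided inverses of the factors.
\<close>
lemma (in monoid) Units_if_mult_Units_both_orders:
  assumes x: "x \<in> carrier G" and y: "y \<in> carrier G"
    and xy: "x \<otimes> y \<in> Units G" and yx: "y \<otimes> x \<in> Units G"
  shows "x \<in> Units G"
proof -
  let ?l = "inv (y \<otimes> x) \<otimes> y" and ?r = "y \<otimes> inv (x \<otimes> y)"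
  have l: "?l \<otimes> x = \<one>" and r: "x \<otimes> ?r = \<one>"
    using x y xy yx by (simp_all add: m_assoc Units_l_inv Units_r_inv flip: m_assoc[of x y])
  moreover have "?l = ?r"
    using inv_unique[OF l r] x y xy yx by simp
  moreover have "?l \<in> carrier G"
    using y yx by simp
  ultimately show ?thesis
    using x unfolding Units_def by auto
qed

lemma (in monoid) mult_Units_both_orders_iff:
  assumes "x \<in> carrier G" "y \<in> carrier G"
  shows "x \<otimes> y \<in> Units G \<and> y \<otimes> x \<in> Units G \<longleftrightarrow> x \<in> Units G \<and> y \<in> Units G"
  using assms Units_if_mult_Units_both_orders by blast

theorem theoremA:
  fixes S :: "('a, 'm) ring_scheme" and a b :: 'a and n :: nat
  assumes "ring S"
    and "n \<ge> 2"
    and "n_potent S n a"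
    and "n_potent S n b"
  shows "(a \<ominus>\<^bsub>S\<^esub> b \<in> Units S \<and> anti_commutator S n a b \<in> Units S) \<longleftrightarrow>
    (a \<oplus>\<^bsub>S\<^esub> b \<in> Units S \<and> left_commutator S n a b \<in> Units S \<and> right_commutator S n a b \<in> Units S)"
proof -
  interpret ring S by fact
  have a: "a \<in> carrier S" "a [^]\<^bsub>S\<^esub> n = a" and b: "b \<in> carrier S" "b [^]\<^bsub>S\<^esub> n = b"
    using assms(3,4) by (auto simp: n_potent_def)
  define s where "s = a \<oplus>\<^bsub>S\<^esub> b"
  define d where "d = a \<ominus>\<^bsub>S\<^esub> b"
  define p where "p = s [^]\<^bsub>S\<^esub> (n - 1)"
  define u where "u = p \<ominus>\<^bsub>S\<^esub> \<one>\<^bsub>S\<^esub>"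
  have [simp]: "s \<in> carrier S" "d \<in> carrier S" "p \<in> carrier S" "u \<in> carrier S"
    using a b by (simp_all add: s_def d_def p_def u_def)
  have n: "n = Suc (n - 1)"
    using assms(2) by simp
  have pow: "s [^]\<^bsub>S\<^esub> n = p \<otimes>\<^bsub>S\<^esub> s" "s [^]\<^bsub>S\<^esub> n = s \<otimes>\<^bsub>S\<^esub> p"
    using n nat_pow_Suc[of s "n - 1"] nat_pow_Suc2[of s "n - 1"] by (simp_all add: p_def)
  have "anti_commutator S n a b = s [^]\<^bsub>S\<^esub> n \<ominus>\<^bsub>S\<^esub> s"
    using a b by (simp add: anti_commutator_def s_def minus_eq minus_add a_ac)
  then have anti: "anti_commutator S n a b = u \<otimes>\<^bsub>S\<^esub> s" "anti_commutator S n a b = s \<otimes>\<^bsub>S\<^esub> u"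
    by (simp add: pow(1) u_def minus_eq l_distr l_minus,
        simp add: pow(2) u_def minus_eq r_distr r_minus)
  have left: "left_commutator S n a b = d \<otimes>\<^bsub>S\<^esub> u"
    unfolding left_commutator_def a(2) b(2) s_def[symmetric] d_def[symmetric] p_def[symmetric]
    by (simp add: u_def minus_eq r_distr r_minus)
  have right: "right_commutator S n a b = u \<otimes>\<^bsub>S\<^esub> d"
    unfolding right_commutator_def a(2) b(2) s_def[symmetric] d_def[symmetric] p_def[symmetric]
    by (simp add: u_def minus_eq l_distr l_minus)
  have "anti_commutator S n a b \<in> Units S \<longleftrightarrow> s \<in> Units S \<and> u \<in> Units S"
    using mult_Units_both_orders_iff[of s u] anti by simp
  moreover have "left_commutator S n a b \<in> Units S \<and> right_commutator S n a b \<in> Units S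
      \<longleftrightarrow> d \<in> Units S \<and> u \<in> Units S"
    using mult_Units_both_orders_iff[of d u] left right by simp
  ultimately show ?thesis
    unfolding s_def[symmetric] d_def[symmetric] by blast
qed

end
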